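(* Let $d\geq 1$ and let $F:\mathbb{R}^d\to\mathbb{R}$ be a cumulative distribution function on $\mathbb{R}^d$ with marginal cumulative distribution functions $F_1,\dots,F_d$. Then there exists a copula $C$ on $\mathbb{R}^d$ such that $$\forall x=(x_1,\dots,x_d)\in\mathbb{R}^d,\qquad F(x)=C\big(F_1(x_1),\dots,F_d(x_d)\big).$$
   Context: For $a=(a_1,\dots,a_d)$ and $b=(b_1,\dots,b_d)$ in $\mathbb{R}^d$, $a\leq b$ means $a_i\leq b_i$ for all $1\leq i\leq d$. For $x,y\in\mathbb{R}^d$, $x\ast y=(x_1y_1,\dots,x_dy_d)$ is the coordinatewise product. For $\varepsilon=(\varepsilon_1,\dots,\varepsilon_d)\in\{0,1\}^d$, $s(\varepsilon)=\varepsilon_1+\cdots+\varepsilon_d$. A mapping $F:\mathbb{R}^d\to\mathbb{R}$ is a distribution function if: (DF1) $F$ is right-continuous, i.e. $F(y)\to F(x)$ as $y\to x$ with $y\geq x$ (coordinatewise); (DF2) $F$ assigns non-negative volumes to cuboids: for all $a\leq b$ in $\mathbb{R}^d$, $$\Delta F(a,b)=\sum_{\varepsilon\in\{0,1\}^d}(-1)^{s(\varepsilon)}F\big(b+\varepsilon\ast(a-b)\big)\geq 0.$$ It is a cumulative distribution function (cdf) if in addition: (DF3a) $F(t_1,\dots,t_d)\to 0$ whenever at least one coordinate $t_i\to-\infty$; (DF3b) $F(t_1,\dots,t_d)\to 1$ when all coordinates $t_i\to+\infty$. For a cdf $F$ on $\mathbb{R}^d$ and $1\leq i\leq d$, the $i$-th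 marginal cdf $F_i:\mathbb{R}\to\mathbb{R}$ is $F_i(s)=F(+\infty,\dots,+\infty,s,+\infty,\dots,+\infty)$ with $s$ in the $i$-th position, i.e. the limit of $F(t_1,\dots,t_d)$ with $t_i=s$ and $t_j\to+\infty$ for all $j\neq i$. A copula on $\mathbb{R}^d$ is a cdf $C$ on $\mathbb{R}^d$ all of whose marginal cdf's $C_1,\dots,C_d$ are equal to the cdf of the uniform distribution on $(0,1)$, i.e. the function equal to $0$ for $s<0$, to $s$ for $0\leq s<1$, and to $1$ for $s\geq 1$. *)

theory Defs
  imports "HOL-Analysis.Analysis"
begin

text \<open>
  Points of d-dimensional space are vectors \<open>x :: real ^ 'n\<close>, where \<open>'n\<close> is an arbitrary finite
  index type with d elements. On such vectors \<open>\<le>\<close> and \<open>*\<close> are the coordinatewise order and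
  product of the library.
\<close>

text \<open>
  The corners of a cuboid are indexed by \<open>nat\<close>-valued 0-1-vectors, so that their coordinate
  sum can serve as the exponent of the sign.
\<close>

definition volume :: "(real ^ 'n \<Rightarrow> real) \<Rightarrow> real ^ 'n \<Rightarrow> real ^ 'n \<Rightarrow> real" where
  "volume F a b =
     (\<Sum>\<epsilon> \<in> {\<epsilon> :: nat ^ 'n. \<forall>i. \<epsilon> $ i \<in> {0, 1}}.
        (-1) ^ (\<Sum>i\<in>UNIV. \<epsilon> $ i) * F (b + (\<chi> i. real (\<epsilon> $ i)) * (a - b)))"

definition distribution_function :: "(real ^ 'n \<Rightarrow> real) \<Rightarrow> bool" where
  "distribution_function F \<longleftrightarrow>
     (\<forall>x. (F \<longlongrightarrow> F x) (at x within {y. x \<le> y})) \<and>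
     (\<forall>a b. a \<le> b \<longrightarrow> volume F a b \<ge> 0)"

text \<open>
  The filter of all \<open>t\<close> with \<open>t $ j \<rightarrow> \<infinity>\<close> jointly for all \<open>j \<in> J\<close>; the coordinates
  outside \<open>J\<close> are unconstrained.
\<close>

definition coords_at_top :: "'n set \<Rightarrow> (real ^ 'n) filter" where
  "coords_at_top J = (INF j\<in>J. filtercomap (\<lambda>t. t $ j) at_top)"

text \<open>
  In the first limit below, only coordinate \<open>i\<close> is required to tend to \<open>-\<infinity>\<close>; the
  other coordinates are arbitrary and need not stay fixed.
\<close>

definition is_cdf :: "(real ^ 'n \<Rightarrow> real) \<Rightarrow> bool" where
  "is_cdf F \<longleftrightarrow>
     distribution_function F \<and>
     (\<forall>i. (F \<longlongrightarrow> 0) (filtercomap (\<lambda>t. t $ i) at_bot)) \<and>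
     (F \<longlongrightarrow> 1) (coords_at_top UNIV)"

text \<open>
  The limit exists whenever \<open>F\<close> is a cdf. In dimension one no coordinate tends to
  infinity, the filter is principal on a single point, and the marginal is \<open>F\<close> itself.
\<close>

definition marginal_cdf :: "(real ^ 'n \<Rightarrow> real) \<Rightarrow> 'n \<Rightarrow> real \<Rightarrow> real" where
  "marginal_cdf F i s = Lim (inf (coords_at_top (- {i})) (principal {t. t $ i = s})) F"

definition uniform_cdf :: "real \<Rightarrow> real" where
  "uniform_cdf s = (if s < 0 then 0 else if s < 1 then s else 1)"

definition copula :: "(real ^ 'n \<Rightarrow> real) \<Rightarrow> bool" where
  "copula C \<longleftrightarrow> is_cdf C \<and> (\<forall>i. marginal_cdf C i = uniform_cdf)"

end

theory Submission
  imports Defs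
begin

text \<open>
  The marginals of \<open>F\<close> are made uniform one coordinate at a time. To transform coordinate \<open>i\<close>, for
  \<open>0 < u < 1\<close> let \<open>q\<close> be the \<open>u\<close>-quantile of the marginal \<open>F\<^sub>i\<close>, so that
  \<open>F\<^sub>i(q-) \<le> u \<le> F\<^sub>i(q)\<close>, and write \<open>u = (1 - w) F\<^sub>i(q-) + w F\<^sub>i(q)\<close>. The new function at
  \<open>x\<^sub>i = u\<close> is \<open>(1 - w) F(\<dots>, q-, \<dots>) + w F(\<dots>, q, \<dots>)\<close>, and for \<open>u \<le> 0\<close> and \<open>u \<ge> 1\<close> it is the
  limit of \<open>F\<close> in that coordinate at minus and plus infinity. The functional \<open>L\<^sub>u\<close> involved here
  is linear in the one-variable section of \<open>F\<close>, and \<open>L\<^sub>u k \<le> L\<^sub>v k\<close> for monotone \<open>k\<close> and \<open>u \<le> v\<close>.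
  Since a cuboid volume is the increment of an alternating sum of sections, and this alternating
  sum is monotone, volumes stay nonnegative. Increments of \<open>F\<close> in coordinate \<open>i\<close> are at most those
  of \<open>F\<^sub>i\<close>, so \<open>F\<close> depends on \<open>x\<^sub>i\<close> through \<open>F\<^sub>i(x\<^sub>i)\<close> only and is recovered from the new function.
\<close>

section \<open>Cuboid volumes as sums over sets of coordinates\<close>

definition vupd :: "'a ^ 'n \<Rightarrow> 'n \<Rightarrow> 'a \<Rightarrow> 'a ^ 'n" where
  "vupd x i s = (\<chi> j. if j = i then s else x $ j)"

lemma vupd_nth [simp]: "vupd x i s $ j = (if j = i then s else x $ j)"
  by (simp add: vupd_def)

lemma vupd_same [simp]: "vupd x i (x $ i) = x"
  by (simp add: vec_eq_iff)

lemma vupd_vupd [simp]: "vupd (vupd x i s) i t = vupd x i t"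
  by (simp add: vec_eq_iff)

lemma vupd_commute: "i \<noteq> j \<Longrightarrow> vupd (vupd x i s) j t = vupd (vupd x j t) i s"
  by (simp add: vec_eq_iff)

lemma vupd_mono:
  fixes s t :: real
  shows "s \<le> t \<Longrightarrow> vupd x i s \<le> vupd x i t"
  by (simp add: less_eq_vec_def)

definition corner :: "'n set \<Rightarrow> 'a ^ 'n \<Rightarrow> 'a ^ 'n \<Rightarrow> 'a ^ 'n" where
  "corner S a b = (\<chi> j. if j \<in> S then a $ j else b $ j)"

lemma corner_nth [simp]: "corner S a b $ j = (if j \<in> S then a $ j else b $ j)"
  by (simp add: corner_def)

lemma volume_corner:
  fixes F :: "real ^ 'n \<Rightarrow> real"
  shows "volume F a b = (\<Sum>S\<in>UNIV. (-1) ^ card S * F (corner S a b))"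
  unfolding volume_def
proof (rule sum.reindex_bij_witness
    [where i = "\<lambda>S. \<chi> j. if j \<in> S then 1 else 0" and j = "\<lambda>\<epsilon>. {j. \<epsilon> $ j = 1}"])
  fix \<epsilon> :: "nat ^ 'n"
  assume "\<epsilon> \<in> {\<epsilon>. \<forall>i. \<epsilon> $ i \<in> {0, 1}}"
  then have e: "\<epsilon> $ i = 0 \<or> \<epsilon> $ i = 1" for i by auto
  have "(\<Sum>i\<in>UNIV. \<epsilon> $ i) = (\<Sum>i\<in>UNIV. if \<epsilon> $ i = 1 then 1 else 0)"
    by (rule sum.cong[OF refl]) (use e in auto)
  also have "\<dots> = card {i. \<epsilon> $ i = 1}"
    by (simp add: sum.If_cases)
  finally have s: "(\<Sum>i\<in>UNIV. \<epsilon> $ i) = card {i. \<epsilon> $ i = 1}" .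
  have c: "b + (\<chi> i. real (\<epsilon> $ i)) * (a - b) = corner {j. \<epsilon> $ j = 1} a b"
    unfolding vec_eq_iff using e by (auto; metis mult_eq_0_iff of_nat_0)
  show "(-1) ^ card {j. \<epsilon> $ j = 1} * F (corner {j. \<epsilon> $ j = 1} a b) =
      (-1) ^ (\<Sum>i\<in>UNIV. \<epsilon> $ i) * F (b + (\<chi> i. real (\<epsilon> $ i)) * (a - b))"
    by (simp only: s c)
  show "(\<chi> j. if j \<in> {j. \<epsilon> $ j = 1} then 1 else 0) = \<epsilon>"
    unfolding vec_eq_iff using e by auto
qed auto

definition face_sum :: "(real ^ 'n \<Rightarrow> real) \<Rightarrow> 'n \<Rightarrow> real ^ 'n \<Rightarrow> real ^ 'n \<Rightarrow> real \<Rightarrow> real" where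
  "face_sum F i a b s = (\<Sum>S\<in>Pow (- {i}). (-1) ^ card S * F (vupd (corner S a b) i s))"

lemma volume_face_sum:
  "volume F a b = face_sum F i a b (b $ i) - face_sum F i a b (a $ i)"
proof -
  have "UNIV = Pow (- {i}) \<union> insert i ` Pow (- {i})" (is "_ = ?P \<union> ?Q")
    by (metis Pow_UNIV Pow_insert insert_UNIV Compl_eq_Diff_UNIV insert_Diff_single)
  moreover have "?P \<inter> ?Q = {}" by auto
  ultimately have "volume F a b = (\<Sum>S\<in>?P. (-1) ^ card S * F (corner S a b))
      + (\<Sum>S\<in>?Q. (-1) ^ card S * F (corner S a b))"
    unfolding volume_corner by (metis (no_types, lifting) finite sum.union_disjoint)
  also have "(\<Sum>S\<in>?P. (-1) ^ card S * F (corner S a b)) = face_sum F i a b (b $ i)"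
    unfolding face_sum_def
  proof (rule sum.cong[OF refl])
    fix S assume "S \<in> ?P"
    then have "corner S a b = vupd (corner S a b) i (b $ i)"
      unfolding vec_eq_iff by auto
    then show "(-1) ^ card S * F (corner S a b)
        = (-1) ^ card S * F (vupd (corner S a b) i (b $ i))" by simp
  qed
  also have "(\<Sum>S\<in>?Q. (-1) ^ card S * F (corner S a b))
      = (\<Sum>S\<in>?P. (-1) ^ card (insert i S) * F (corner (insert i S) a b))"
    by (subst sum.reindex) (auto simp: inj_on_def insert_eq_iff)
  also have "\<dots> = - face_sum F i a b (a $ i)"
    unfolding face_sum_def sum_negf[symmetric]
  proof (rule sum.cong[OF refl])
    fix S assume S: "S \<in> ?P"
    then have "corner (insert i S) a b = vupd (corner S a b) i (a $ i)"
      unfolding vec_eq_iff by auto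
    moreover have "card (insert i S) = Suc (card S)"
      using S by (intro card_insert_disjoint) auto
    ultimately show "(-1) ^ card (insert i S) * F (corner (insert i S) a b)
        = - ((-1) ^ card S * F (vupd (corner S a b) i (a $ i)))" by simp
  qed
  finally show ?thesis by simp
qed

section \<open>Transporting a one-dimensional cdf to the uniform one\<close>

definition cdf1 :: "(real \<Rightarrow> real) \<Rightarrow> bool" where
  "cdf1 m \<longleftrightarrow> mono m \<and> (\<forall>s. (m \<longlongrightarrow> m s) (at_right s)) \<and>
     (m \<longlongrightarrow> 0) at_bot \<and> (m \<longlongrightarrow> 1) at_top"

lemma cdf1_bounds:
  assumes "cdf1 m"
  shows "0 \<le> m s" "m s \<le> 1"
proof -
  have m: "mono m" "(m \<longlongrightarrow> 0) at_bot" "(m \<longlongrightarrow> 1) at_top"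
    using assms by (auto simp: cdf1_def)
  show "0 \<le> m s"
    by (rule tendsto_upperbound[OF m(2)])
      (auto intro: eventually_mono[OF eventually_le_at_bot[of s]] monoD[OF m(1)])
  show "m s \<le> 1"
    by (rule tendsto_lowerbound[OF m(3)])
      (auto intro: eventually_mono[OF eventually_ge_at_top[of s]] monoD[OF m(1)])
qed

lemma cdf1_uniform: "cdf1 uniform_cdf"
  unfolding cdf1_def
proof (intro conjI allI)
  show "mono uniform_cdf" by (auto simp: mono_def uniform_cdf_def)
  have eq: "uniform_cdf = (\<lambda>s. max 0 (min 1 s))" by (auto simp: uniform_cdf_def fun_eq_iff)
  show "(uniform_cdf \<longlongrightarrow> uniform_cdf s) (at_right s)" for s
    unfolding eq by (intro tendsto_intros)
  show "(uniform_cdf \<longlongrightarrow> 0) at_bot"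
    by (rule tendsto_eventually, rule eventually_mono[OF eventually_le_at_bot[of "-1"]])
      (auto simp: uniform_cdf_def)
  show "(uniform_cdf \<longlongrightarrow> 1) at_top"
    by (rule tendsto_eventually, rule eventually_mono[OF eventually_ge_at_top[of 1]])
      (auto simp: uniform_cdf_def)
qed

definition quantile :: "(real \<Rightarrow> real) \<Rightarrow> real \<Rightarrow> real" where
  "quantile m u = Inf {s. u \<le> m s}"

lemma quantile_galois:
  assumes m: "cdf1 m" and u: "0 < u" "u < 1"
  shows "quantile m u \<le> s \<longleftrightarrow> u \<le> m s"
proof -
  let ?A = "{s. u \<le> m s}"
  have rc: "(m \<longlongrightarrow> m s) (at_right s)" for s
    using m by (auto simp: cdf1_def)
  have mono: "mono m" and bot: "(m \<longlongrightarrow> 0) at_bot" and top: "(m \<longlongrightarrow> 1) at_top"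
    using m by (auto simp: cdf1_def)
  have "eventually (\<lambda>s. m s < u) at_bot" using order_tendstoD(2)[OF bot] u by simp
  then obtain c where c: "m c < u" by (auto simp: eventually_at_bot_linorder)
  have "c \<le> s" if "s \<in> ?A" for s
    using c monoD[OF mono, of s c] that by (cases "c \<le> s") auto
  then have bdd: "bdd_below ?A" by (rule bdd_belowI)
  have "eventually (\<lambda>s. u < m s) at_top" using order_tendstoD(1)[OF top] u by simp
  then obtain d where d: "u < m d" by (auto simp: eventually_at_top_linorder)
  then have ne: "?A \<noteq> {}" by (auto intro: less_imp_le)
  have "u \<le> m (quantile m u)"
  proof (rule tendsto_lowerbound[OF rc])
    show "\<forall>\<^sub>F s in at_right (quantile m u). u \<le> m s"
      unfolding eventually_at_right_field
    proof (intro exI[of _ "quantile m u + 1"] conjI allI impI)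
      fix s assume "quantile m u < s"
      then obtain t where "t \<in> ?A" "t < s"
        unfolding quantile_def using cInf_less_iff[OF ne bdd] by auto
      then show "u \<le> m s" using monoD[OF mono, of t s] by simp
    qed simp
  qed simp
  then show ?thesis
    using monoD[OF mono, of "quantile m u" s] cInf_lower[OF _ bdd, of s]
    by (auto simp: quantile_def)
qed

text \<open>
  The weights \<open>w\<close> and points \<open>p\<close>, \<open>r\<close> spread every jump of \<open>m\<close> linearly over the gap that it leaves
  in the range of \<open>m\<close>: for \<open>0 < u < 1\<close>, \<open>r n u\<close> is the quantile of \<open>u\<close> and \<open>p n u\<close> approaches it
  from the left; otherwise both are \<open>- n\<close> or \<open>n\<close>.
\<close>

lemma uniformization:
  assumes m: "cdf1 m"
  obtains w :: "real \<Rightarrow> real" and p r :: "nat \<Rightarrow> real \<Rightarrow> real" where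
    "\<And>u. 0 \<le> w u" "\<And>u. w u \<le> 1"
    "\<And>u. convergent (\<lambda>n. m (p n u))" "\<And>u. convergent (\<lambda>n. m (r n u))"
    "\<And>k u v. mono k \<Longrightarrow> u \<le> v \<Longrightarrow> \<forall>\<^sub>F n in sequentially.
        (1 - w u) * k (p n u) + w u * k (r n u) \<le> (1 - w v) * k (p n v) + w v * k (r n v)"
    "\<And>u. (\<lambda>n. (1 - w u) * m (p n u) + w u * m (r n u)) \<longlonglongrightarrow> uniform_cdf u"
    "\<And>s. (\<forall>n. m (p n (m s)) \<le> m s \<and> m (r n (m s)) \<le> m s) \<or>
          (\<forall>n. m s \<le> m (p n (m s)) \<and> m s \<le> m (r n (m s)))"
proof -
  have mono: "mono m" and bot: "(m \<longlongrightarrow> 0) at_bot" and top: "(m \<longlongrightarrow> 1) at_top"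
    using m by (auto simp: cdf1_def)
  let ?q = "quantile m"
  define l where "l u = lim (\<lambda>n. m (?q u - 1 / real (Suc n)))" for u
  define w where "w u = (if 0 < u \<and> u < 1 then (u - l u) / (m (?q u) - l u) else 0)" for u
  define p where "p n u = (if u \<le> 0 then - real n else if u < 1 then ?q u - 1 / real (Suc n)
      else real n)" for n u
  define r where "r n u = (if u \<le> 0 then - real n else if u < 1 then ?q u else real n)" for n u
  have l: "(\<lambda>n. m (?q u - 1 / real (Suc n))) \<longlonglongrightarrow> l u" for u
  proof -
    have "incseq (\<lambda>n. m (?q u - 1 / real (Suc n)))"
      by (intro incseq_SucI monoD[OF mono] diff_left_mono) (simp add: divide_simps)
    then have "convergent (\<lambda>n. m (?q u - 1 / real (Suc n)))"
      by (rule incseq_convergent[of _ 1]) (use cdf1_bounds[OF m] in \<open>auto simp: convergent_def\<close>)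
    then show ?thesis unfolding l_def by (simp add: convergent_LIMSEQ_iff)
  qed
  have mbot: "(\<lambda>n. m (- real n)) \<longlonglongrightarrow> 0"
    by (rule filterlim_compose[OF bot])
      (rule filterlim_compose[OF filterlim_uminus_at_bot_at_top filterlim_real_sequentially])
  have mtop: "(\<lambda>n. m (real n)) \<longlonglongrightarrow> 1"
    by (rule filterlim_compose[OF top filterlim_real_sequentially])
  have lu: "l u \<le> u" if "0 < u" "u < 1" for u
  proof (rule tendsto_upperbound[OF l])
    show "\<forall>\<^sub>F n in sequentially. m (?q u - 1 / real (Suc n)) \<le> u"
      using quantile_galois[OF m that]
      by (intro always_eventually allI) (smt (verit) divide_pos_pos of_nat_0_less_iff zero_less_Suc)
  qed simp
  have uh: "u \<le> m (?q u)" if "0 < u" "u < 1" for u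
    using quantile_galois[OF m that] by blast
  have w0: "0 \<le> w u" for u
    unfolding w_def using lu[of u] uh[of u] by (auto intro!: divide_nonneg_nonneg)
  have w1: "w u \<le> 1" for u
    unfolding w_def using lu[of u] uh[of u] by (auto simp: divide_le_eq_1)
  have wu: "(1 - w u) * l u + w u * m (?q u) = u" if "0 < u" "u < 1" for u
  proof (cases "m (?q u) = l u")
    case True
    then show ?thesis using lu[OF that] uh[OF that] by (simp add: algebra_simps)
  next
    case False
    then have "w u * (m (?q u) - l u) = u - l u" using that by (simp add: w_def)
    then show ?thesis by (simp add: algebra_simps)
  qed
  show thesis
  proof (rule that[of w p r])
    show "0 \<le> w u" "w u \<le> 1" for u by (fact w0 w1)+
    show "convergent (\<lambda>n. m (p n u))" for u
      using mbot mtop l[of u] unfolding convergent_def p_def by (cases "u \<le> 0"; cases "u < 1") auto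
    show "convergent (\<lambda>n. m (r n u))" for u
      using mbot mtop unfolding convergent_def r_def by (cases "u \<le> 0"; cases "u < 1") auto
    show "(\<lambda>n. (1 - w u) * m (p n u) + w u * m (r n u)) \<longlonglongrightarrow> uniform_cdf u" for u
    proof -
      consider "u \<le> 0" | "0 < u" "u < 1" | "1 \<le> u" by linarith
      then show ?thesis
      proof cases
        case 1 then show ?thesis using mbot by (auto simp: w_def p_def r_def uniform_cdf_def)
      next
        case 2
        have "(\<lambda>n. (1 - w u) * m (?q u - 1 / real (Suc n)) + w u * m (?q u)) \<longlonglongrightarrow>
            (1 - w u) * l u + w u * m (?q u)"
          by (intro tendsto_intros l)
        then show ?thesis using 2 by (simp add: wu p_def r_def uniform_cdf_def)
      next
        case 3 then show ?thesis using mtop by (auto simp: w_def p_def r_def uniform_cdf_def)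
      qed
    qed
    show "(\<forall>n. m (p n (m s)) \<le> m s \<and> m (r n (m s)) \<le> m s) \<or>
          (\<forall>n. m s \<le> m (p n (m s)) \<and> m s \<le> m (r n (m s)))" for s
    proof -
      consider "m s = 0" | "0 < m s" "m s < 1" | "m s = 1"
        using cdf1_bounds[OF m, of s] by linarith
      then show ?thesis
      proof cases
        case 1 then show ?thesis using cdf1_bounds[OF m] by simp
      next
        case 2
        have "?q (m s) \<le> s" using quantile_galois[OF m 2] by blast
        moreover from this have "?q (m s) - 1 / real (Suc n) \<le> s" for n
          by (rule order_trans[rotated]) simp
        ultimately have "m (p n (m s)) \<le> m s" "m (r n (m s)) \<le> m s" for n
          using 2 monoD[OF mono] by (simp_all add: p_def r_def del: of_nat_Suc)
        then show ?thesis by blast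
      next
        case 3 then show ?thesis using cdf1_bounds[OF m] by simp
      qed
    qed
    fix k :: "real \<Rightarrow> real" and u v :: real
    assume k: "mono k" and uv: "u \<le> v"
    have pr: "k (p n u) \<le> k (r n u)" for n u
      by (rule monoD[OF k]) (simp add: p_def r_def)
    have low: "k (p n u) \<le> (1 - w u) * k (p n u) + w u * k (r n u)" for n u
      using mult_nonneg_nonneg[OF w0[of u], of "k (r n u) - k (p n u)"] pr[of n u]
      by (simp add: algebra_simps)
    have upp: "(1 - w u) * k (p n u) + w u * k (r n u) \<le> k (r n u)" for n u
      using mult_nonneg_nonneg[of "1 - w u" "k (r n u) - k (p n u)"] w1[of u] pr[of n u]
      by (simp add: algebra_simps)
    have large: "\<forall>\<^sub>F n in sequentially. x \<le> real n" for x
      using filterlim_real_sequentially by (simp add: filterlim_at_top)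
    have small: "\<forall>\<^sub>F n in sequentially. 1 / real (Suc n) < x" if "0 < x" for x
      using order_tendstoD(2)[OF LIMSEQ_inverse_real_of_nat that] by (simp add: inverse_eq_divide)
    consider "w u = w v" "\<forall>n. p n u = p n v \<and> r n u = r n v"
      | "\<forall>\<^sub>F n in sequentially. r n u \<le> p n v"
      | "0 < u" "v < 1" "?q u = ?q v"
    proof -
      consider "v \<le> 0" | "u \<le> 0" "0 < v" "v < 1" | "u \<le> 0" "1 \<le> v"
        | "0 < u" "v < 1" "?q u = ?q v" | "0 < u" "v < 1" "?q u < ?q v"
        | "0 < u" "u < 1" "1 \<le> v" | "1 \<le> u"
      proof -
        have "?q u \<le> ?q v" if "0 < u" "v < 1"
          using quantile_galois[OF m, of u "?q v"] uh[of v] that uv by simp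
        then show thesis using that uv by linarith
      qed
      then show thesis
      proof cases
        case 1 then show ?thesis using uv by (intro that(1)) (auto simp: w_def p_def r_def)
      next
        case 2
        show ?thesis
        proof (rule that(2), rule eventually_mono[OF large[of "1 - ?q v"]])
          fix n assume "1 - ?q v \<le> real n"
          moreover have "1 / real (Suc n) \<le> 1" by simp
          ultimately have "- real n \<le> ?q v - 1 / real (Suc n)" by linarith
          then show "r n u \<le> p n v" using 2 by (simp add: r_def p_def)
        qed
      next
        case 3 then show ?thesis by (intro that(2)) (simp add: r_def p_def)
      next
        case 4 then show ?thesis by (rule that(3))
      next
        case 5
        then show ?thesis using uv
          by (intro that(2) eventually_mono[OF small[of "?q v - ?q u"]]) (auto simp: r_def p_def)
      next
        case 6
        then show ?thesis
          by (intro that(2) eventually_mono[OF large[of "?q u"]]) (auto simp: r_def p_def)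
      next
        case 7 then show ?thesis using uv by (intro that(1)) (auto simp: w_def p_def r_def)
      qed
    qed
    then show "\<forall>\<^sub>F n in sequentially.
        (1 - w u) * k (p n u) + w u * k (r n u) \<le> (1 - w v) * k (p n v) + w v * k (r n v)"
    proof cases
      case 1 then show ?thesis by simp
    next
      case 2
      then show ?thesis
        by (rule eventually_mono) (meson low upp monoD[OF k] order_trans)
    next
      case 3
      then have "l u = l v" by (simp add: l_def)
      then have "w u \<le> w v"
        using 3 uv lu[of v] uh[of v] by (auto simp: w_def intro!: divide_right_mono)
      moreover have "p n u = p n v" "r n u = r n v" for n
        using 3 uv by (auto simp: p_def r_def)
      ultimately have "0 \<le> (w v - w u) * (k (r n v) - k (p n v))"
        "p n u = p n v" "r n u = r n v" for n
        using pr by (auto intro!: mult_nonneg_nonneg)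
      then show ?thesis by (intro always_eventually) (simp add: algebra_simps)
    qed
  qed
qed


section \<open>Functions with prescribed marginals\<close>

text \<open>
  A limit-free description of the cdfs with marginals \<open>m\<close>. It consists of inequalities between
  finitely many values of \<open>F\<close> only, so it passes to mixtures and to pointwise limits. The last
  two clauses are the Frechet bounds.
\<close>

definition has_marginals :: "(real ^ 'n \<Rightarrow> real) \<Rightarrow> ('n \<Rightarrow> real \<Rightarrow> real) \<Rightarrow> bool" where
  "has_marginals F m \<longleftrightarrow>
     (\<forall>a b. a \<le> b \<longrightarrow> 0 \<le> volume F a b) \<and>
     (\<forall>x i s t. s \<le> t \<longrightarrow> 0 \<le> F (vupd x i t) - F (vupd x i s) \<and>
        F (vupd x i t) - F (vupd x i s) \<le> m i t - m i s) \<and>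
     (\<forall>x i. 0 \<le> F x \<and> F x \<le> m i (x $ i)) \<and>
     (\<forall>x. 1 - (\<Sum>i\<in>UNIV. 1 - m i (x $ i)) \<le> F x)"

lemma has_marginalsD:
  assumes "has_marginals F m"
  shows "a \<le> b \<Longrightarrow> 0 \<le> volume F a b"
    and "s \<le> t \<Longrightarrow> 0 \<le> F (vupd x i t) - F (vupd x i s)"
    and "s \<le> t \<Longrightarrow> F (vupd x i t) - F (vupd x i s) \<le> m i t - m i s"
    and "0 \<le> F x" and "F x \<le> m i (x $ i)"
    and "1 - (\<Sum>i\<in>UNIV. 1 - m i (x $ i)) \<le> F x"
  using assms unfolding has_marginals_def by blast+

lemma convergent_along_coordinate:
  assumes F: "has_marginals F m" and q: "convergent (\<lambda>n. m i (q n))"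
  shows "convergent (\<lambda>n. F (vupd x i (q n)))"
proof -
  have d: "dist (F (vupd x i s)) (F (vupd x i t)) \<le> dist (m i s) (m i t)" for s t
    using has_marginalsD(2,3)[OF F, of s t x i] has_marginalsD(2,3)[OF F, of t s x i]
    by (cases "s \<le> t") (auto simp: dist_real_def)
  have "Cauchy (\<lambda>n. m i (q n))" using q by (rule convergent_Cauchy)
  then have "Cauchy (\<lambda>n. F (vupd x i (q n)))"
    unfolding Cauchy_def by (meson d le_less_trans)
  then show ?thesis by (rule Cauchy_convergent)
qed

lemma mono_face_sum:
  assumes F: "has_marginals F m" and ab: "a \<le> b"
  shows "mono (face_sum F i a b)"
proof (rule monoI)
  fix s t :: real assume st: "s \<le> t"
  have "face_sum F i (vupd a i s) (vupd b i t) z = face_sum F i a b z" for z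
    unfolding face_sum_def
    by (intro sum.cong refl arg_cong[where f = "\<lambda>x. _ * F x"]) (auto simp: vec_eq_iff)
  then have "volume F (vupd a i s) (vupd b i t) = face_sum F i a b t - face_sum F i a b s"
    using volume_face_sum[of F "vupd a i s" "vupd b i t" i] by simp
  moreover have "vupd a i s \<le> vupd b i t"
    using ab st by (auto simp: less_eq_vec_def)
  ultimately show "face_sum F i a b s \<le> face_sum F i a b t"
    using has_marginalsD(1)[OF F, of "vupd a i s" "vupd b i t"] by simp
qed

lemma uniformize_coordinate:
  fixes F :: "real ^ 'n \<Rightarrow> real"
  assumes F: "has_marginals F m" and m: "cdf1 (m i)"
  obtains G where "has_marginals G (m(i := uniform_cdf))"
    "\<And>x. F x = G (vupd x i (m i (x $ i)))"
proof -
  obtain w :: "real \<Rightarrow> real" and p r :: "nat \<Rightarrow> real \<Rightarrow> real" where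
    w: "\<And>u. 0 \<le> w u" "\<And>u. w u \<le> 1"
    and conv: "\<And>u. convergent (\<lambda>n. m i (p n u))" "\<And>u. convergent (\<lambda>n. m i (r n u))"
    and mono: "\<And>k u v. mono k \<Longrightarrow> u \<le> v \<Longrightarrow> \<forall>\<^sub>F n in sequentially.
        (1 - w u) * k (p n u) + w u * k (r n u) \<le> (1 - w v) * k (p n v) + w v * k (r n v)"
    and unif: "\<And>u. (\<lambda>n. (1 - w u) * m i (p n u) + w u * m i (r n u)) \<longlonglongrightarrow> uniform_cdf u"
    and side: "\<And>s. (\<forall>n. m i (p n (m i s)) \<le> m i s \<and> m i (r n (m i s)) \<le> m i s) \<or>
          (\<forall>n. m i s \<le> m i (p n (m i s)) \<and> m i s \<le> m i (r n (m i s)))"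
    by (rule uniformization[OF m]) (rule that)
  define A where "A n u k = (1 - w u) * k (p n u) + w u * k (r n u)" for n u and k :: "real \<Rightarrow> real"
  note mono = mono[folded A_def] and unif = unif[folded A_def]
  have A_le: "A n u k \<le> A n u k'" if "\<And>s. k s \<le> k' s" for n u k k'
    unfolding A_def using w that by (intro add_mono mult_left_mono) auto
  have A_diff: "A n u (\<lambda>s. k s - k' s) = A n u k - A n u k'" for n u k k'
    by (simp add: A_def algebra_simps)
  have A_add: "A n u (\<lambda>s. k s + c) = A n u k + c" for n u k c
    by (simp add: A_def algebra_simps)
  have A_const: "A n u (\<lambda>s. c) = c" for n u c
    by (simp add: A_def algebra_simps)
  define H where "H n x = A n (x $ i) (\<lambda>s. F (vupd x i s))" for n x
  define G where "G x = lim (\<lambda>n. H n x)" for x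
  have lim: "(\<lambda>n. H n x) \<longlonglongrightarrow> G x" for x
  proof -
    have "convergent (\<lambda>n. F (vupd x i (p n (x $ i))))" "convergent (\<lambda>n. F (vupd x i (r n (x $ i))))"
      by (rule convergent_along_coordinate[OF F] conv)+
    then obtain b c where "(\<lambda>n. F (vupd x i (p n (x $ i)))) \<longlonglongrightarrow> b"
      "(\<lambda>n. F (vupd x i (r n (x $ i)))) \<longlonglongrightarrow> c" by (auto simp: convergent_def)
    then have "(\<lambda>n. H n x) \<longlonglongrightarrow> (1 - w (x $ i)) * b + w (x $ i) * c"
      unfolding H_def A_def by (intro tendsto_intros)
    then show ?thesis unfolding G_def by (metis limI)
  qed
  have H_upd: "H n (vupd x i u) = A n u (\<lambda>s. F (vupd x i s))" for n x u
    by (simp add: H_def)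
  have H_upd': "H n (vupd x j u) = A n (x $ i) (\<lambda>s. F (vupd (vupd x i s) j u))"
    if "j \<noteq> i" for n x j u
    using that by (simp add: H_def vupd_commute)
  show thesis
  proof (rule that)
    have "0 \<le> volume G a b" if ab: "a \<le> b" for a b
    proof -
      let ?K = "face_sum F i a b"
      have "face_sum (H n) i a b s = A n s ?K" for n s
        unfolding face_sum_def H_upd A_def sum_distrib_left sum.distrib[symmetric]
        by (simp add: algebra_simps)
      then have vol: "volume (H n) a b = A n (b $ i) ?K - A n (a $ i) ?K" for n
        by (simp add: volume_face_sum[of _ a b i])
      have "(\<lambda>n. volume (H n) a b) \<longlonglongrightarrow> volume G a b"
        unfolding volume_corner by (intro tendsto_intros lim)
      moreover have "a $ i \<le> b $ i" using ab by (simp add: less_eq_vec_def)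
      then have "\<forall>\<^sub>F n in sequentially. 0 \<le> volume (H n) a b"
        unfolding vol using mono[OF mono_face_sum[OF F ab]] by simp
      ultimately show ?thesis by (rule tendsto_lowerbound) simp
    qed
    moreover have "0 \<le> G (vupd x j t) - G (vupd x j s) \<and>
        G (vupd x j t) - G (vupd x j s) \<le> (m(i := uniform_cdf)) j t - (m(i := uniform_cdf)) j s"
      if st: "s \<le> t" for x j s t
    proof (cases "j = i")
      case True
      let ?k = "\<lambda>s. F (vupd x i s)"
      have "mono ?k" "mono (\<lambda>s. m i s - ?k s)"
        using has_marginalsD(2,3)[OF F, of _ _ x i] by (auto simp: mono_def algebra_simps)
      note ev = this[THEN mono, OF st]
      have "G (vupd x i s) \<le> G (vupd x i t)"
        using tendsto_le[OF _ lim lim ev(1)[folded H_upd]] by simp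
      moreover have "uniform_cdf s - G (vupd x i s) \<le> uniform_cdf t - G (vupd x i t)"
        using ev(2) unfolding A_diff H_upd[symmetric]
        by (rule tendsto_le[OF _ tendsto_diff[OF unif lim] tendsto_diff[OF unif lim], rotated]) simp
      ultimately show ?thesis using True by simp
    next
      case False
      have d: "(\<lambda>n. H n (vupd x j t) - H n (vupd x j s)) \<longlonglongrightarrow> G (vupd x j t) - G (vupd x j s)"
        by (intro tendsto_intros lim)
      have "0 \<le> H n (vupd x j t) - H n (vupd x j s)"
        "H n (vupd x j t) - H n (vupd x j s) \<le> m j t - m j s" for n
        unfolding H_upd'[OF False] A_diff[symmetric]
        using A_le[of "\<lambda>_. 0" "\<lambda>z. F (vupd (vupd x i z) j t) - F (vupd (vupd x i z) j s)" n "x $ i"]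
          A_le[of "\<lambda>z. F (vupd (vupd x i z) j t) - F (vupd (vupd x i z) j s)"
            "\<lambda>_. m j t - m j s" n "x $ i"]
          has_marginalsD(2,3)[OF F st] unfolding A_const by auto
      then show ?thesis
        using LIMSEQ_le_const[OF d, of 0] LIMSEQ_le_const2[OF d, of "m j t - m j s"] False by auto
    qed
    moreover have "0 \<le> G x" for x
    proof (rule LIMSEQ_le_const[OF lim], intro exI allI impI)
      show "0 \<le> H n x" for n
        using A_le[of "\<lambda>_. 0" "\<lambda>s. F (vupd x i s)"] has_marginalsD(4)[OF F]
        unfolding H_def A_const by blast
    qed
    moreover have "G x \<le> (m(i := uniform_cdf)) j (x $ j)" for x j
    proof (cases "j = i")
      case True
      have "H n x \<le> A n (x $ i) (m i)" for n
        unfolding H_def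
        using has_marginalsD(5)[OF F, of "vupd x i _" i] by (intro A_le) simp
      then show ?thesis using True LIMSEQ_le[OF lim unif] by auto
    next
      case False
      have "H n x \<le> A n (x $ i) (\<lambda>_. m j (x $ j))" for n
        unfolding H_def
        using has_marginalsD(5)[OF F, of "vupd x i _" j] False by (intro A_le) simp
      then show ?thesis using False LIMSEQ_le_const2[OF lim] unfolding A_const by auto
    qed
    moreover have "1 - (\<Sum>j\<in>UNIV. 1 - (m(i := uniform_cdf)) j (x $ j)) \<le> G x" for x
    proof -
      let ?c = "(\<Sum>j\<in>-{i}. 1 - m j (x $ j))"
      have split: "(\<Sum>j\<in>UNIV. f j) = f i + sum f (-{i})" for f :: "'n \<Rightarrow> real"
        by (simp add: Compl_eq_Diff_UNIV sum.remove)
      have "m i s + (- ?c) \<le> F (vupd x i s)" for s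
      proof -
        have "(\<Sum>j\<in>-{i}. 1 - m j (vupd x i s $ j)) = ?c"
          by (rule sum.cong) auto
        then have "1 - (\<Sum>j\<in>UNIV. 1 - m j (vupd x i s $ j)) = m i s + (- ?c)"
          unfolding split by simp
        then show ?thesis using has_marginalsD(6)[OF F, of "vupd x i s"] by simp
      qed
      then have "A n (x $ i) (m i) + (- ?c) \<le> H n x" for n
        unfolding H_def A_add[symmetric] by (rule A_le)
      moreover have "(\<lambda>n. A n (x $ i) (m i) + (- ?c)) \<longlonglongrightarrow> uniform_cdf (x $ i) + (- ?c)"
        by (intro tendsto_intros unif)
      ultimately have "uniform_cdf (x $ i) + (- ?c) \<le> G x" using lim LIMSEQ_le by blast
      moreover have "(\<Sum>j\<in>-{i}. 1 - (m(i := uniform_cdf)) j (x $ j)) = ?c"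
        by (rule sum.cong) auto
      ultimately show ?thesis unfolding split by simp
    qed
    ultimately show "has_marginals G (m(i := uniform_cdf))"
      unfolding has_marginals_def by blast
    show "F x = G (vupd x i (m i (x $ i)))" for x
    proof -
      let ?s = "x $ i" and ?u = "m i (x $ i)"
      have near: "\<bar>F (vupd x i t) - F x\<bar> \<le> \<bar>m i t - ?u\<bar>" for t
        using has_marginalsD(2,3)[OF F, of t ?s x i] has_marginalsD(2,3)[OF F, of ?s t x i]
        by (cases "t \<le> ?s") auto
      have "\<bar>A n ?u (\<lambda>s. F (vupd x i s)) - F x\<bar> \<le> \<bar>A n ?u (m i) - ?u\<bar>" for n
      proof -
        have "A n ?u k - c = (1 - w ?u) * (k (p n ?u) - c) + w ?u * (k (r n ?u) - c)" for k c
          by (simp add: A_def algebra_simps)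
        note eq = this
        have "\<bar>A n ?u (\<lambda>s. F (vupd x i s)) - F x\<bar>
            \<le> (1 - w ?u) * \<bar>F (vupd x i (p n ?u)) - F x\<bar> + w ?u * \<bar>F (vupd x i (r n ?u)) - F x\<bar>"
          unfolding eq using w[of ?u] by (intro order_trans[OF abs_triangle_ineq]) (simp add: abs_mult)
        also have "\<dots> \<le> (1 - w ?u) * \<bar>m i (p n ?u) - ?u\<bar> + w ?u * \<bar>m i (r n ?u) - ?u\<bar>"
          using w[of ?u] by (intro add_mono mult_left_mono near) auto
        also have "\<dots> = \<bar>A n ?u (m i) - ?u\<bar>"
          using side[of ?s]
        proof
          assume "\<forall>n. m i (p n ?u) \<le> ?u \<and> m i (r n ?u) \<le> ?u"
          then have "m i (p n ?u) - ?u \<le> 0" "m i (r n ?u) - ?u \<le> 0" by auto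
          moreover from this have "A n ?u (m i) - ?u \<le> 0"
            unfolding eq using w[of ?u] by (intro add_nonpos_nonpos mult_nonneg_nonpos) auto
          ultimately show ?thesis by (simp add: eq algebra_simps)
        next
          assume "\<forall>n. ?u \<le> m i (p n ?u) \<and> ?u \<le> m i (r n ?u)"
          then have "0 \<le> m i (p n ?u) - ?u" "0 \<le> m i (r n ?u) - ?u" by auto
          moreover from this have "0 \<le> A n ?u (m i) - ?u"
            unfolding eq using w[of ?u] by (intro add_nonneg_nonneg mult_nonneg_nonneg) auto
          ultimately show ?thesis by (simp add: eq)
        qed
        finally show ?thesis .
      qed
      moreover have "(\<lambda>n. \<bar>A n ?u (m i) - ?u\<bar>) \<longlonglongrightarrow> 0"
      proof -
        have "uniform_cdf ?u = ?u" using cdf1_bounds[OF m, of ?s] by (auto simp: uniform_cdf_def)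
        then show ?thesis using unif[of ?u] by (simp add: LIM_zero tendsto_rabs_zero)
      qed
      ultimately have "(\<lambda>n. A n ?u (\<lambda>s. F (vupd x i s)) - F x) \<longlonglongrightarrow> 0"
        using Lim_null_comparison[OF always_eventually] by (metis (no_types, lifting) real_norm_def)
      then have "(\<lambda>n. H n (vupd x i ?u)) \<longlonglongrightarrow> F x"
        unfolding H_upd by (rule LIM_zero_cancel)
      then show ?thesis using LIMSEQ_unique lim by blast
    qed
  qed
qed

lemma uniformize_coordinates:
  fixes F :: "real ^ 'n \<Rightarrow> real"
  assumes F: "has_marginals F m" and m: "\<And>i. cdf1 (m i)"
  shows "\<exists>G. has_marginals G (\<lambda>i. if i \<in> J then uniform_cdf else m i) \<and>
    (\<forall>x. F x = G (\<chi> i. if i \<in> J then m i (x $ i) else x $ i))"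
  using finite[of J]
proof induction
  case empty
  then show ?case using F by (intro exI[of _ F]) simp
next
  case (insert j J)
  let ?m = "\<lambda>J i. if i \<in> J then uniform_cdf else m i"
  obtain G where G: "has_marginals G (?m J)"
    "\<And>x. F x = G (\<chi> i. if i \<in> J then m i (x $ i) else x $ i)"
    using insert.IH by blast
  have j: "?m J j = m j" using insert.hyps by simp
  have "cdf1 (?m J j)" unfolding j by (rule m)
  then obtain H where H: "has_marginals H ((?m J)(j := uniform_cdf))"
    "\<And>x. G x = H (vupd x j (?m J j (x $ j)))"
    by (rule uniformize_coordinate[OF G(1)]) (rule that)
  have "(?m J)(j := uniform_cdf) = ?m (insert j J)" by (auto simp: fun_eq_iff)
  moreover have "F x = H (\<chi> i. if i \<in> insert j J then m i (x $ i) else x $ i)" for x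
    unfolding G(2) H(2) j using insert.hyps
    by (intro arg_cong[where f = H]) (auto simp: vec_eq_iff)
  ultimately show ?case using H(1) by (intro exI[of _ H]) simp
qed

section \<open>From prescribed marginals to cdfs\<close>

lemma increment_le_sum:
  fixes F :: "real ^ 'n \<Rightarrow> real"
  assumes step: "\<And>x i s t. s \<le> t \<Longrightarrow> F (vupd x i t) - F (vupd x i s) \<le> m i t - m i s"
    and "x \<le> y"
  shows "F y - F x \<le> (\<Sum>i\<in>UNIV. m i (y $ i) - m i (x $ i))"
proof -
  have "F (corner J y x) - F x \<le> (\<Sum>i\<in>J. m i (y $ i) - m i (x $ i))" for J
    using finite[of J]
  proof induction
    case empty
    have "corner {} y x = x" by (simp add: vec_eq_iff)
    then show ?case by simp
  next
    case (insert i J)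
    have "corner (insert i J) y x = vupd (corner J y x) i (y $ i)"
      "corner J y x = vupd (corner J y x) i (x $ i)"
      using insert.hyps by (auto simp: vec_eq_iff)
    moreover have "x $ i \<le> y $ i" using \<open>x \<le> y\<close> by (simp add: less_eq_vec_def)
    ultimately have "F (corner (insert i J) y x) - F (corner J y x) \<le> m i (y $ i) - m i (x $ i)"
      using step by metis
    then show ?case using insert by simp
  qed
  from this[of UNIV] show ?thesis by (simp add: corner_def)
qed

lemma mono_coordinatewise:
  fixes F :: "real ^ 'n \<Rightarrow> real"
  assumes "\<And>x i s t. s \<le> t \<Longrightarrow> F (vupd x i s) \<le> F (vupd x i t)"
  shows "mono F"
proof (rule monoI)
  fix x y :: "real ^ 'n" assume "x \<le> y"
  then show "F x \<le> F y"
    using increment_le_sum[of "\<lambda>x. - F x" "\<lambda>_ _. 0" x y] assms by simp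
qed

lemma filterlim_coords_at_top:
  "i \<in> J \<Longrightarrow> filterlim (\<lambda>t. t $ i) at_top (coords_at_top J)"
  unfolding coords_at_top_def
  by (rule filterlim_mono[OF filterlim_filtercomap order_refl]) (rule INF_lower)

lemma filterlim_into_coords_at_top:
  "(\<And>i. i \<in> J \<Longrightarrow> filterlim (\<lambda>z. f z $ i) at_top G) \<Longrightarrow> filterlim f (coords_at_top J) G"
  unfolding coords_at_top_def filterlim_INF filterlim_filtercomap_iff by (simp add: o_def)

definition ray :: "'n \<Rightarrow> real \<Rightarrow> real \<Rightarrow> real ^ 'n" where
  "ray i s z = vupd (\<chi> j. z) i s"

lemma ray_nth [simp]: "ray i s z $ j = (if j = i then s else z)"
  by (simp add: ray_def)

definition fiber_at_top :: "'n \<Rightarrow> real \<Rightarrow> (real ^ 'n) filter" where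
  "fiber_at_top i s = inf (coords_at_top (- {i})) (principal {t. t $ i = s})"

lemma marginal_cdf_fiber: "marginal_cdf F i s = Lim (fiber_at_top i s) F"
  by (simp add: marginal_cdf_def fiber_at_top_def)

lemma filterlim_ray: "filterlim (ray i s) (fiber_at_top i s) at_top"
  unfolding fiber_at_top_def filterlim_inf
proof
  show "filterlim (ray i s) (coords_at_top (- {i})) at_top"
    by (rule filterlim_into_coords_at_top) (simp add: filterlim_ident)
qed (simp add: filterlim_principal)

lemma fiber_at_top_neq_bot: "fiber_at_top i s \<noteq> bot"
  using filterlim_ray[of i s] by (auto simp: filterlim_def filtermap_bot_iff bot_unique)

lemma filterlim_fiber_at_top:
  "j \<noteq> i \<Longrightarrow> filterlim (\<lambda>t. t $ j) at_top (fiber_at_top i s)"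
  unfolding fiber_at_top_def
  by (rule filterlim_mono[OF filterlim_coords_at_top[of j "- {i}"] order_refl]) auto

lemma eventually_fiber_at_top: "\<forall>\<^sub>F t in fiber_at_top i s. t $ i = s"
  unfolding fiber_at_top_def by (auto simp: eventually_inf_principal)

lemma tendsto_frechet_fiber:
  fixes m :: "'n :: finite \<Rightarrow> real \<Rightarrow> real"
  assumes "\<And>j. (m j \<longlongrightarrow> 1) at_top"
  shows "((\<lambda>t. 1 - (\<Sum>j\<in>UNIV. 1 - m j (t $ j))) \<longlongrightarrow> m i s) (fiber_at_top i s)"
    and "((\<lambda>t. m i (t $ i)) \<longlongrightarrow> m i s) (fiber_at_top i s)"
proof -
  have "((\<lambda>t. m j (t $ j)) \<longlongrightarrow> (if j = i then m i s else 1)) (fiber_at_top i s)" for j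
  proof (cases "j = i")
    case True
    then show ?thesis
      by (auto intro!: tendsto_eventually eventually_mono[OF eventually_fiber_at_top])
  next
    case False
    then show ?thesis
      using filterlim_compose[OF assms filterlim_fiber_at_top[OF False]] by simp
  qed
  note lim = this
  have "((\<lambda>t. 1 - (\<Sum>j\<in>UNIV. 1 - m j (t $ j))) \<longlongrightarrow>
      1 - (\<Sum>j\<in>UNIV. 1 - (if j = i then m i s else 1))) (fiber_at_top i s)"
    by (intro tendsto_intros lim)
  moreover have "(\<Sum>j\<in>UNIV. 1 - (if j = i then m i s else 1)) = (\<Sum>j\<in>UNIV. if j = i then 1 - m i s else 0)"
    by (rule sum.cong) auto
  ultimately show "((\<lambda>t. 1 - (\<Sum>j\<in>UNIV. 1 - m j (t $ j))) \<longlongrightarrow> m i s) (fiber_at_top i s)"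
    by simp
  show "((\<lambda>t. m i (t $ i)) \<longlongrightarrow> m i s) (fiber_at_top i s)"
    using lim[of i] by simp
qed

lemma has_marginals_is_cdf:
  fixes F :: "real ^ 'n \<Rightarrow> real"
  assumes F: "has_marginals F m" and m: "\<And>i. cdf1 (m i)"
  shows "is_cdf F" and "marginal_cdf F i = m i"
proof -
  have top: "(m i \<longlongrightarrow> 1) at_top" and bot: "(m i \<longlongrightarrow> 0) at_bot" for i
    using m by (auto simp: cdf1_def)
  show "marginal_cdf F i = m i" for i
  proof
    fix s
    have "(F \<longlongrightarrow> m i s) (fiber_at_top i s)"
      by (rule tendsto_sandwich[OF _ _ tendsto_frechet_fiber[of m, OF top]])
        (use has_marginalsD(5,6)[OF F] in \<open>auto intro: always_eventually\<close>)
    then show "marginal_cdf F i s = m i s"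
      unfolding marginal_cdf_fiber by (intro tendsto_Lim fiber_at_top_neq_bot)
  qed
  show "is_cdf F"
    unfolding is_cdf_def distribution_function_def
  proof (intro conjI allI impI)
    show "0 \<le> volume F a b" if "a \<le> b" for a b
      using has_marginalsD(1)[OF F that] .
    have "mono F"
      by (rule mono_coordinatewise) (use has_marginalsD(2)[OF F] in simp)
    show "(F \<longlongrightarrow> F x) (at x within {y. x \<le> y})" for x
    proof (rule tendsto_sandwich)
      let ?up = "\<lambda>y. F x + (\<Sum>i\<in>UNIV. m i (y $ i) - m i (x $ i))"
      show "\<forall>\<^sub>F y in at x within {y. x \<le> y}. F x \<le> F y"
        using monoD[OF \<open>mono F\<close>, of x] by (auto simp: eventually_at_filter)
      show "\<forall>\<^sub>F y in at x within {y. x \<le> y}. F y \<le> ?up y"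
        using increment_le_sum[of F m x, OF has_marginalsD(3)[OF F]]
        by (auto simp: eventually_at_filter algebra_simps intro!: always_eventually)
      have "((\<lambda>y. m i (y $ i)) \<longlongrightarrow> m i (x $ i)) (at x within {y. x \<le> y})" for i
      proof -
        have "{x $ i..} - {x $ i} = {x $ i<..} - {x $ i}" by auto
        then have "at (x $ i) within {x $ i..} = at_right (x $ i)"
          by (simp add: at_within_def)
        then have "continuous (at (x $ i) within {x $ i..}) (m i)"
          using m[of i] by (simp add: cdf1_def continuous_within)
        then have "continuous (at (x $ i) within (\<lambda>y. y $ i) ` {y. x \<le> y}) (m i)"
          by (rule continuous_within_subset) (auto simp: less_eq_vec_def)
        then have "continuous (at x within {y. x \<le> y}) (\<lambda>y. m i (y $ i))"
          by (rule continuous_within_compose2[rotated]) (auto simp: continuous_within intro!: tendsto_intros)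
        then show ?thesis by (simp add: continuous_within)
      qed
      then have "(?up \<longlongrightarrow> F x + (\<Sum>i\<in>UNIV. m i (x $ i) - m i (x $ i))) (at x within {y. x \<le> y})"
        by (intro tendsto_intros)
      then show "(?up \<longlongrightarrow> F x) (at x within {y. x \<le> y})" by simp
    qed simp
    show "(F \<longlongrightarrow> 0) (filtercomap (\<lambda>t. t $ i) at_bot)" for i
      by (rule tendsto_sandwich[OF _ _ tendsto_const filterlim_compose[OF bot[of i] filterlim_filtercomap]])
        (use has_marginalsD(4,5)[OF F] in \<open>auto intro: always_eventually\<close>)
    have "((\<lambda>t. 1 - (\<Sum>i\<in>UNIV. 1 - m i (t $ i))) \<longlongrightarrow> 1 - (\<Sum>i\<in>(UNIV :: 'n set). 1 - 1)) (coords_at_top UNIV)"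
      by (intro tendsto_intros filterlim_compose[OF top filterlim_coords_at_top]) simp
    then have lim: "((\<lambda>t. 1 - (\<Sum>i\<in>UNIV. 1 - m i (t $ i))) \<longlongrightarrow> 1) (coords_at_top UNIV)" by simp
    have "\<forall>t. F t \<le> 1"
      using has_marginalsD(5)[OF F] cdf1_bounds(2)[OF m] order_trans by blast
    then show "(F \<longlongrightarrow> 1) (coords_at_top UNIV)"
      using has_marginalsD(6)[OF F]
      by (intro tendsto_sandwich[OF always_eventually always_eventually lim tendsto_const]) auto
  qed
qed

section \<open>From cdfs to prescribed marginals\<close>

lemma face_volume_nonneg:
  fixes F :: "real ^ 'n \<Rightarrow> real"
  assumes F: "is_cdf F" and ab: "a \<le> b"
  shows "0 \<le> (\<Sum>S\<in>Pow J. (-1) ^ card S * F (corner S a b))"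
proof -
  define c where "c n = (\<chi> j. if j \<in> J then a $ j else b $ j - real n)" for n :: nat
  have "(\<lambda>n. F (corner S (c n) b)) \<longlonglongrightarrow> (if S \<in> Pow J then F (corner S a b) else 0)" for S
  proof (cases "S \<subseteq> J")
    case True
    then have "corner S (c n) b = corner S a b" for n by (auto simp: vec_eq_iff c_def)
    then show ?thesis using True by simp
  next
    case False
    then obtain j where j: "j \<in> S" "j \<notin> J" by auto
    have "filterlim (\<lambda>n. - b $ j + real n) at_top sequentially"
      by (intro filterlim_tendsto_add_at_top[OF tendsto_const] filterlim_real_sequentially)
    then have "filterlim (\<lambda>n. b $ j - real n) at_bot sequentially"
      by (subst filterlim_uminus_at_bot) (simp add: algebra_simps)
    then have "filterlim (\<lambda>n. corner S (c n) b) (filtercomap (\<lambda>t. t $ j) at_bot) sequentially"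
      using j by (simp add: filterlim_filtercomap_iff o_def c_def)
    moreover have "(F \<longlongrightarrow> 0) (filtercomap (\<lambda>t. t $ j) at_bot)"
      using F by (simp add: is_cdf_def)
    ultimately have "(\<lambda>n. F (corner S (c n) b)) \<longlonglongrightarrow> 0" by (rule filterlim_compose[rotated])
    then show ?thesis using False by simp
  qed
  then have "(\<lambda>n. volume F (c n) b) \<longlonglongrightarrow>
      (\<Sum>S\<in>UNIV. (-1) ^ card S * (if S \<in> Pow J then F (corner S a b) else 0))"
    unfolding volume_corner by (intro tendsto_intros)
  also have "(\<Sum>S\<in>UNIV. (-1) ^ card S * (if S \<in> Pow J then F (corner S a b) else 0))
      = (\<Sum>S\<in>Pow J. (-1) ^ card S * F (corner S a b))"
    by (rule sum.mono_neutral_cong_right) auto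
  finally have "(\<lambda>n. volume F (c n) b) \<longlonglongrightarrow> (\<Sum>S\<in>Pow J. (-1) ^ card S * F (corner S a b))" .
  moreover have "0 \<le> volume F (c n) b" for n
  proof -
    have "c n \<le> b" using ab by (auto simp: c_def less_eq_vec_def)
    then show ?thesis using F by (simp add: is_cdf_def distribution_function_def)
  qed
  ultimately show ?thesis by (intro LIMSEQ_le_const) auto
qed

lemma cdf_nonneg:
  assumes "is_cdf F"
  shows "0 \<le> F x"
proof -
  have "corner {} x x = x" by (simp add: vec_eq_iff)
  then show ?thesis using face_volume_nonneg[OF assms, of x x "{}"] by simp
qed

lemma cdf_mono:
  fixes F :: "real ^ 'n \<Rightarrow> real"
  assumes "is_cdf F"
  shows "mono F"
proof (rule mono_coordinatewise)
  fix x :: "real ^ 'n" and i and s t :: real assume "s \<le> t"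
  let ?a = "vupd x i s" and ?b = "vupd x i t"
  have "?a \<le> ?b" using \<open>s \<le> t\<close> by (rule vupd_mono)
  moreover have "corner {} ?a ?b = ?b" "corner {i} ?a ?b = ?a" by (auto simp: vec_eq_iff)
  moreover have "Pow {i} = {{}, {i}}" by auto
  ultimately show "F ?a \<le> F ?b" using face_volume_nonneg[OF assms, of ?a ?b "{i}"] by simp
qed

lemma cdf_increment_mono:
  fixes F :: "real ^ 'n \<Rightarrow> real"
  assumes F: "is_cdf F" and st: "s \<le> t"
  shows "mono (\<lambda>x. F (vupd x i t) - F (vupd x i s))"
proof (rule mono_coordinatewise)
  fix x :: "real ^ 'n" and j and u v :: real assume uv: "u \<le> v"
  show "F (vupd (vupd x j u) i t) - F (vupd (vupd x j u) i s)
      \<le> F (vupd (vupd x j v) i t) - F (vupd (vupd x j v) i s)"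
  proof (cases "j = i")
    case False
    let ?a = "vupd (vupd x j u) i s" and ?b = "vupd (vupd x j v) i t"
    have "?a \<le> ?b" using st uv by (simp add: less_eq_vec_def)
    moreover have "corner {} ?a ?b = ?b" "corner {i} ?a ?b = vupd (vupd x j v) i s"
      "corner {j} ?a ?b = vupd (vupd x j u) i t" "corner {i, j} ?a ?b = ?a"
      using False by (auto simp: vec_eq_iff)
    moreover have "Pow {i, j} = {{}, {i}, {j}, {i, j}}" by auto
    moreover have "{i} \<noteq> {j}" "{i} \<noteq> {i, j}" "{j} \<noteq> {i, j}" using False by auto
    ultimately show ?thesis
      using face_volume_nonneg[OF F, of ?a ?b "{i, j}"] False by simp
  qed simp
qed

lemma cdf_le_1:
  fixes F :: "real ^ 'n \<Rightarrow> real"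
  assumes F: "is_cdf F"
  shows "F x \<le> 1"
proof -
  have "\<forall>\<^sub>F t in coords_at_top UNIV. \<forall>i. x $ i \<le> t $ i"
    using filterlim_coords_at_top by (intro eventually_all_finite) (auto simp: filterlim_at_top)
  then have "\<forall>\<^sub>F t in coords_at_top UNIV. F x \<le> F t"
    by (rule eventually_mono) (auto intro!: monoD[OF cdf_mono[OF F]] simp: less_eq_vec_def)
  moreover have "(F \<longlongrightarrow> 1) (coords_at_top UNIV)" using F by (simp add: is_cdf_def)
  moreover have "coords_at_top UNIV \<noteq> (bot :: (real ^ 'n) filter)"
  proof -
    have "filterlim (\<lambda>z. (\<chi> j. z) :: real ^ 'n) (coords_at_top UNIV) at_top"
      by (rule filterlim_into_coords_at_top) (simp add: filterlim_ident)
    then show ?thesis by (auto simp: filterlim_def filtermap_bot_iff bot_unique)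
  qed
  ultimately show ?thesis using tendsto_lowerbound by blast
qed

lemma cdf_marginal:
  assumes F: "is_cdf F"
  shows tendsto_marginal_cdf: "((\<lambda>z. F (ray i s z)) \<longlongrightarrow> marginal_cdf F i s) at_top"
    and le_marginal_cdf: "F x \<le> marginal_cdf F i (x $ i)"
proof -
  note mono = monoD[OF cdf_mono[OF F]]
  have bdd: "bdd_above (range (\<lambda>z. F (ray i s z)))" for s
    using cdf_le_1[OF F] by (intro bdd_aboveI[of _ 1]) auto
  let ?M = "\<lambda>s. SUP z. F (ray i s z)"
  have le: "F x \<le> ?M (x $ i)" for x
  proof -
    define z where "z = Max (range (\<lambda>j. x $ j))"
    have "x \<le> ray i (x $ i) z" by (auto simp: less_eq_vec_def z_def)
    then show ?thesis using mono cSUP_upper[OF UNIV_I bdd] order_trans by blast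
  qed
  have lim: "(F \<longlongrightarrow> ?M s) (fiber_at_top i s)" for s
  proof (rule order_tendstoI)
    fix a assume "a < ?M s"
    then obtain z where z: "a < F (ray i s z)" using less_cSUP_iff[OF _ bdd] by auto
    have "\<forall>\<^sub>F t in fiber_at_top i s. \<forall>j. ray i s z $ j \<le> t $ j"
    proof (rule eventually_all_finite)
      show "\<forall>\<^sub>F t in fiber_at_top i s. ray i s z $ j \<le> t $ j" for j
        using filterlim_fiber_at_top[of j i s] eventually_mono[OF eventually_fiber_at_top[of i s]]
        by (cases "j = i") (auto simp: filterlim_at_top)
    qed
    then show "\<forall>\<^sub>F t in fiber_at_top i s. a < F t"
    proof (rule eventually_mono)
      fix t assume "\<forall>j. ray i s z $ j \<le> t $ j"
      then have "F (ray i s z) \<le> F t" by (intro mono) (simp add: less_eq_vec_def)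
      then show "a < F t" using z by simp
    qed
  next
    fix a assume "?M s < a"
    then show "\<forall>\<^sub>F t in fiber_at_top i s. F t < a"
      using le by (intro eventually_mono[OF eventually_fiber_at_top]) (metis le_less_trans)
  qed
  have eq: "marginal_cdf F i s = ?M s" for s
    unfolding marginal_cdf_fiber by (intro tendsto_Lim fiber_at_top_neq_bot lim)
  show "((\<lambda>z. F (ray i s z)) \<longlongrightarrow> marginal_cdf F i s) at_top"
    unfolding eq by (rule filterlim_compose[OF lim filterlim_ray])
  show "F x \<le> marginal_cdf F i (x $ i)" unfolding eq by (rule le)
qed

lemma tendsto_cdf_diagonal:
  assumes F: "is_cdf F"
  shows "((\<lambda>z. F (\<chi> j. z)) \<longlongrightarrow> 1) at_top"
proof -
  have "filterlim (\<lambda>z. \<chi> j. z) (coords_at_top UNIV) at_top"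
    by (rule filterlim_into_coords_at_top) (simp add: filterlim_ident)
  then show ?thesis using F filterlim_compose by (auto simp: is_cdf_def)
qed

lemma eventually_le_diagonal:
  fixes x :: "real ^ 'n"
  shows "\<forall>\<^sub>F z in at_top. \<forall>j. x $ j \<le> z"
  by (rule eventually_all_finite) (rule eventually_ge_at_top)

lemma marginal_cdf_le_1:
  assumes F: "is_cdf F"
  shows "marginal_cdf F i s \<le> 1"
  by (rule tendsto_upperbound[OF tendsto_marginal_cdf[OF F]])
    (auto intro: always_eventually cdf_le_1[OF F])

lemma cdf_increment_le:
  assumes F: "is_cdf F" and st: "s \<le> t"
  shows "F (vupd x i t) - F (vupd x i s) \<le> marginal_cdf F i t - marginal_cdf F i s"
proof (rule tendsto_lowerbound)
  show "((\<lambda>z. F (ray i t z) - F (ray i s z)) \<longlongrightarrow> marginal_cdf F i t - marginal_cdf F i s) at_top"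
    by (intro tendsto_diff tendsto_marginal_cdf[OF F])
  show "\<forall>\<^sub>F z in at_top. F (vupd x i t) - F (vupd x i s) \<le> F (ray i t z) - F (ray i s z)"
    using eventually_le_diagonal[of x]
  proof (rule eventually_mono)
    fix z assume "\<forall>j. x $ j \<le> z"
    then show "F (vupd x i t) - F (vupd x i s) \<le> F (ray i t z) - F (ray i s z)"
      unfolding ray_def by (intro monoD[OF cdf_increment_mono[OF F st]]) (simp add: less_eq_vec_def)
  qed
qed simp

lemma cdf_frechet_lower:
  fixes F :: "real ^ 'n \<Rightarrow> real"
  assumes F: "is_cdf F"
  shows "1 - (\<Sum>i\<in>UNIV. 1 - marginal_cdf F i (x $ i)) \<le> F x"
proof -
  let ?c = "\<Sum>i\<in>UNIV. 1 - marginal_cdf F i (x $ i)"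
  have "1 \<le> F x + ?c"
  proof (rule tendsto_upperbound[OF tendsto_cdf_diagonal[OF F]])
    show "\<forall>\<^sub>F z in at_top. F (\<chi> j. z) \<le> F x + ?c"
      using eventually_le_diagonal[of x]
    proof (rule eventually_mono)
      fix z assume "\<forall>j. x $ j \<le> z"
      then have "F (\<chi> j. z) - F x
          \<le> (\<Sum>i\<in>UNIV. marginal_cdf F i ((\<chi> j. z) $ i) - marginal_cdf F i (x $ i))"
        by (intro increment_le_sum[of F, OF cdf_increment_le[OF F]]) (simp_all add: less_eq_vec_def)
      also have "\<dots> \<le> ?c"
        by (intro sum_mono diff_right_mono marginal_cdf_le_1[OF F])
      finally show "F (\<chi> j. z) \<le> F x + ?c" by simp
    qed
  qed simp
  then show ?thesis by simp
qed

lemma is_cdf_has_marginals: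
  assumes F: "is_cdf F"
  shows "has_marginals F (marginal_cdf F)"
  unfolding has_marginals_def
proof (intro conjI allI impI)
  show "0 \<le> F (vupd x i t) - F (vupd x i s)" if "s \<le> t" for x i s t
    using monoD[OF cdf_mono[OF F] vupd_mono[OF that]] by simp
qed (use F in \<open>auto intro: cdf_increment_le cdf_nonneg le_marginal_cdf cdf_frechet_lower
      simp: is_cdf_def distribution_function_def\<close>)

lemma cdf1_marginal_cdf:
  fixes F :: "real ^ 'n \<Rightarrow> real"
  assumes F: "is_cdf F"
  shows "cdf1 (marginal_cdf F i)"
  unfolding cdf1_def
proof (intro conjI allI)
  let ?M = "marginal_cdf F"
  note mono_F = monoD[OF cdf_mono[OF F]]
  show mono: "mono (?M i)" for i
  proof (rule monoI)
    fix s t :: real assume "s \<le> t"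
    then show "?M i s \<le> ?M i t"
      using cdf_increment_le[OF F, of s t 0 i]
        mono_F[OF vupd_mono[of s t 0 i]] by simp
  qed
  show top: "(?M i \<longlongrightarrow> 1) at_top" for i
  proof (rule tendsto_sandwich[OF _ _ tendsto_cdf_diagonal[OF F] tendsto_const])
    show "\<forall>\<^sub>F z in at_top. F (\<chi> j. z) \<le> ?M i z"
      using le_marginal_cdf[OF F, of "\<chi> j. _" i] by (intro always_eventually) simp
  qed (simp add: marginal_cdf_le_1[OF F])
  show "(?M i \<longlongrightarrow> 0) at_bot"
  proof (rule tendstoI)
    fix e :: real assume "0 < e"
    have "(F \<longlongrightarrow> 0) (filtercomap (\<lambda>t. t $ i) at_bot)" using F by (simp add: is_cdf_def)
    then have "\<forall>\<^sub>F t in filtercomap (\<lambda>t. t $ i) at_bot. F t < e / 2"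
      using \<open>0 < e\<close> by (intro order_tendstoD(2)) auto
    then obtain c where c: "\<And>t. t $ i \<le> c \<Longrightarrow> F t < e / 2"
      unfolding eventually_filtercomap_at_bot_linorder by blast
    have "dist (?M i s) 0 < e" if "s \<le> c" for s
    proof -
      have "?M i s \<le> e / 2"
        using c[of "ray i s _"] that
        by (intro tendsto_upperbound[OF tendsto_marginal_cdf[OF F]] always_eventually)
          (auto intro: less_imp_le)
      moreover have "0 \<le> ?M i s"
        using le_marginal_cdf[OF F, of "ray i s 0" i] cdf_nonneg[OF F, of "ray i s 0"] by simp
      ultimately show ?thesis using \<open>0 < e\<close> by simp
    qed
    then show "\<forall>\<^sub>F s in at_bot. dist (?M i s) 0 < e"
      by (intro eventually_mono[OF eventually_le_at_bot[of c]])
  qed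
  show "(?M i \<longlongrightarrow> ?M i s) (at_right s)" for s
  proof (rule order_tendstoI)
    fix a assume "a < ?M i s"
    then show "\<forall>\<^sub>F t in at_right s. a < ?M i t"
      using monoD[OF mono[of i], of s]
      by (intro eventually_mono[OF eventually_at_right_less]) (smt (verit))
  next
    fix a assume a: "?M i s < a"
    define \<eta> where "\<eta> z = (\<Sum>j\<in>-{i}. 1 - ?M j z)" for z
    have "(\<eta> \<longlongrightarrow> (\<Sum>j\<in>-{i}. 1 - 1)) at_top"
      unfolding \<eta>_def by (intro tendsto_intros top)
    then have "\<forall>\<^sub>F z in at_top. \<eta> z < a - ?M i s"
      using a by (intro order_tendstoD(2)) auto
    then obtain z where z: "\<eta> z < a - ?M i s" by (auto simp: eventually_at_top_linorder)
    have near: "?M i t \<le> F (ray i t z) + \<eta> z" for t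
    proof (rule tendsto_upperbound[OF tendsto_marginal_cdf[OF F]])
      show "\<forall>\<^sub>F y in at_top. F (ray i t y) \<le> F (ray i t z) + \<eta> z"
        using eventually_ge_at_top[of z]
      proof (rule eventually_mono)
        fix y assume "z \<le> y"
        then have "F (ray i t y) - F (ray i t z)
            \<le> (\<Sum>j\<in>UNIV. ?M j (ray i t y $ j) - ?M j (ray i t z $ j))"
          by (intro increment_le_sum[of F, OF cdf_increment_le[OF F]]) (simp_all add: less_eq_vec_def)
        also have "\<dots> = (\<Sum>j\<in>-{i}. ?M j y - ?M j z)"
          by (rule sum.mono_neutral_cong_right) auto
        also have "\<dots> \<le> \<eta> z"
          unfolding \<eta>_def by (intro sum_mono diff_right_mono marginal_cdf_le_1[OF F])
        finally show "F (ray i t y) \<le> F (ray i t z) + \<eta> z" by simp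
      qed
    qed simp
    have "(F \<longlongrightarrow> F (ray i s z)) (at (ray i s z) within {y. ray i s z \<le> y})"
      using F by (simp add: is_cdf_def distribution_function_def)
    moreover have "filterlim (\<lambda>t. ray i t z) (at (ray i s z) within {y. ray i s z \<le> y}) (at_right s)"
      unfolding filterlim_at
    proof
      show "\<forall>\<^sub>F t in at_right s. ray i t z \<in> {y. ray i s z \<le> y} \<and> ray i t z \<noteq> ray i s z"
      proof (rule eventually_mono[OF eventually_at_right_less])
        fix t assume "s < t"
        then have "ray i t z $ i \<noteq> ray i s z $ i" by simp
        then have "ray i t z \<noteq> ray i s z" by metis
        then show "ray i t z \<in> {y. ray i s z \<le> y} \<and> ray i t z \<noteq> ray i s z"
          using \<open>s < t\<close> by (simp add: less_eq_vec_def)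
      qed
      show "((\<lambda>t. ray i t z) \<longlongrightarrow> ray i s z) (at_right s)"
        by (rule vec_tendstoI) (simp add: tendsto_ident_at)
    qed
    ultimately have "((\<lambda>t. F (ray i t z)) \<longlongrightarrow> F (ray i s z)) (at_right s)"
      by (rule filterlim_compose)
    moreover have "F (ray i s z) < a - \<eta> z"
      using le_marginal_cdf[OF F, of "ray i s z" i] z by simp
    ultimately have "\<forall>\<^sub>F t in at_right s. F (ray i t z) < a - \<eta> z"
      by (rule order_tendstoD(2))
    then show "\<forall>\<^sub>F t in at_right s. ?M i t < a"
      by (rule eventually_mono) (use near in \<open>smt (verit)\<close>)
  qed
qed

theorem theorem1:
  fixes F :: "real ^ 'n \<Rightarrow> real"
  assumes "is_cdf F"
  shows "\<exists>C :: real ^ 'n \<Rightarrow> real. copula C \<and>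
           (\<forall>x. F x = C (\<chi> i. marginal_cdf F i (x $ i)))"
proof -
  obtain C where C: "has_marginals C (\<lambda>_. uniform_cdf)"
    "\<forall>x. F x = C (\<chi> i. marginal_cdf F i (x $ i))"
    using uniformize_coordinates[OF is_cdf_has_marginals[OF assms] cdf1_marginal_cdf[OF assms],
        of UNIV] by auto
  then show ?thesis
    using has_marginals_is_cdf[OF C(1) cdf1_uniform] by (auto simp: copula_def)
qed

end
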